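(* Let $1\le p_1,p_2\le\infty$ and $0<p_3\le\infty$. If there exists a non-zero continuous and integrable function $M$ belonging to $\tilde{\mathcal M}_{(p_1,p_2,p_3)}(\mathbb R)$, then $$\frac1{p_3}\le\frac1{p_1}+\frac1{p_2}\le\frac1{p_3}+1.$$
   Context: The Fourier transform is $\hat f(\xi)=\int_{\mathbb R}f(x)e^{-2\pi i x\xi}dx$. $\mathcal P(\mathbb R)$ denotes the set of Schwartz functions on $\mathbb R$ whose Fourier transform is continuous with compact support. $\tilde{\mathcal M}_{(p_1,p_2,p_3)}(\mathbb R)$ is the space of measurable (locally integrable) $M:\mathbb R\to\mathbb C$ such that the bilinear operator $B_M(f,g)(x)=\int_{\mathbb R}\int_{\mathbb R}\hat f(\xi)\hat g(\eta)M(\xi-\eta)e^{2\pi i(\xi+\eta)x}d\xi\,d\eta$, $f,g\in\mathcal P(\mathbb R)$, satisfies $\|B_M(f,g)\|_{p_3}\le C\|f\|_{p_1}\|g\|_{p_2}$ for some $C$ and all $f,g\in\mathcal P(\mathbb R)$. *)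

theory Defs
  imports "HOL-Analysis.Analysis" "HOL-Probability.Essential_Supremum"
begin

definition fourier :: "(real \<Rightarrow> complex) \<Rightarrow> real \<Rightarrow> complex" where
  "fourier f \<xi> = (LINT x|lborel. f x * cis (- 2 * pi * x * \<xi>))"

definition nth_deriv :: "nat \<Rightarrow> (real \<Rightarrow> complex) \<Rightarrow> real \<Rightarrow> complex" where
  "nth_deriv n f = ((\<lambda>g x. vector_derivative g (at x)) ^^ n) f"

definition schwartz :: "(real \<Rightarrow> complex) \<Rightarrow> bool" where
  "schwartz f \<longleftrightarrow>
     (\<forall>n x. nth_deriv n f differentiable (at x)) \<and>
     (\<forall>k n. bounded (range (\<lambda>x. complex_of_real (x ^ k) * nth_deriv n f x)))"

definition classP :: "(real \<Rightarrow> complex) set" where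
  "classP = {f. schwartz f \<and> continuous_on UNIV (fourier f) \<and>
                 compact (closure {\<xi>. fourier f \<xi> \<noteq> 0})}"

definition lp_norm :: "ereal \<Rightarrow> (real \<Rightarrow> complex) \<Rightarrow> ennreal" where
  "lp_norm p f =
     (if p = \<infinity> then esssup lborel (\<lambda>x. ennreal (norm (f x)))
      else (let I = (\<integral>\<^sup>+ x. ennreal (norm (f x) powr real_of_ereal p) \<partial>lborel)
            in if I = \<infinity> then \<infinity> else ennreal (enn2real I powr (1 / real_of_ereal p))))"

definition bilin_op :: "(real \<Rightarrow> complex) \<Rightarrow> (real \<Rightarrow> complex) \<Rightarrow> (real \<Rightarrow> complex) \<Rightarrow> real \<Rightarrow> complex" where
  "bilin_op M f g x =
     (LINT \<eta>|lborel. LINT \<xi>|lborel.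
        fourier f \<xi> * fourier g \<eta> * M (\<xi> - \<eta>) * cis (2 * pi * (\<xi> + \<eta>) * x))"

definition locally_integrable :: "(real \<Rightarrow> complex) \<Rightarrow> bool" where
  "locally_integrable M \<longleftrightarrow> M \<in> borel_measurable lborel \<and>
     (\<forall>K. compact K \<longrightarrow> set_integrable lborel K M)"

definition multiplier_class :: "ereal \<Rightarrow> ereal \<Rightarrow> ereal \<Rightarrow> (real \<Rightarrow> complex) set" where
  "multiplier_class p1 p2 p3 = {M. locally_integrable M \<and>
     (\<exists>C::real. \<forall>f\<in>classP. \<forall>g\<in>classP.
        lp_norm p3 (bilin_op M f g) \<le> ennreal C * lp_norm p1 f * lp_norm p2 g)}"

end

theory Submission
  imports Defs "HOL-Probability.Probability"
begin

text \<open>Both inequalities come from dilating test functions. Let \<open>b\<close> be a smooth bump and let the Fourier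
  transforms of \<open>f\<close> and \<open>g\<close> be modulated copies of \<open>b\<close> dilated by \<open>l\<close>; then \<open>B\<^sub>M(f, g)(y / l)\<close> is, up
  to a unimodular factor, a double integral of \<open>b(u) b(v) N\<^sub>l(u - v) e(y(u + v))\<close>, where \<open>N\<^sub>l\<close> is a
  modulated dilate of \<open>M\<close>. As \<open>l \<rightarrow> 0\<close> this converges to a multiple of \<open>M(t\<^sub>0)\<close>, and \<open>t\<^sub>0\<close> can be
  chosen with \<open>M(t\<^sub>0) \<noteq> 0\<close>. As \<open>l \<rightarrow> \<infinity>\<close>, \<open>l N\<^sub>l\<close> acts as an approximate identity of mass
  \<open>fourier M s\<close>, which is nonzero for some \<open>s\<close>. In both cases Fatou's lemma bounds the
  \<open>L\<^sup>p\<close> norm from below, and comparing powers of \<open>l\<close> gives the two inequalities.\<close>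

section \<open>Smooth functions of compact support and their Fourier integrals\<close>

text \<open>Carrying the power of \<open>x\<close> as a parameter makes the family closed under
  differentiation, up to linear combinations.\<close>

definition flat :: "nat \<Rightarrow> real \<Rightarrow> real" where
  "flat k x = (if 0 < x then exp (- 1 / x) / x ^ k else 0)"

lemma flat_has_real_derivative:
  "(flat k has_real_derivative flat (k + 2) x - real k * flat (k + 1) x) (at x)"
proof -
  consider "0 < x" | "x < 0" | "x = 0" by linarith
  then show ?thesis
  proof cases
    case 1
    have "real k * x ^ (k - Suc 0) = real k * x ^ k / x"
      using 1 by (cases k) auto
    then have "exp (- 1 / x) * (1 / x\<^sup>2) * inverse (x ^ k)
        + exp (- 1 / x) * - (inverse (x ^ k) * (real k * x ^ (k - Suc 0)) * inverse (x ^ k))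
        = flat (k + 2) x - real k * flat (k + 1) x"
      using 1 by (auto simp: flat_def field_simps power2_eq_square)
    moreover have "((\<lambda>x. exp (- 1 / x) * inverse (x ^ k)) has_real_derivative
        exp (- 1 / x) * (1 / x\<^sup>2) * inverse (x ^ k)
        + exp (- 1 / x) * - (inverse (x ^ k) * (real k * x ^ (k - Suc 0)) * inverse (x ^ k))) (at x)"
      using 1 by (auto intro!: derivative_eq_intros simp: power2_eq_square)
    ultimately have "((\<lambda>x. exp (- 1 / x) * inverse (x ^ k)) has_real_derivative
        flat (k + 2) x - real k * flat (k + 1) x) (at x)"
      by metis
    then show ?thesis
      by (rule has_field_derivative_transform_within_open[where S="{0<..}"])
        (use 1 in \<open>auto simp: flat_def field_simps\<close>)
  next
    case 2
    have "((\<lambda>x. 0) has_real_derivative flat (k + 2) x - real k * flat (k + 1) x) (at x)"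
      using 2 by (simp add: flat_def)
    then show ?thesis
      by (rule has_field_derivative_transform_within_open[where S="{..<0}"])
        (use 2 in \<open>auto simp: flat_def\<close>)
  next
    case 3
    \<comment> \<open>At 0 the right difference quotient of \<open>flat k\<close>, written in
      \<open>inverse y\<close>, is a power over an exponential at infinity, so it vanishes in the
      limit.\<close>
    have "((\<lambda>y::real. inverse y ^ (k + 1) / exp (inverse y)) \<longlongrightarrow> 0) (at_right 0)"
      by (rule filterlim_compose[OF tendsto_power_div_exp_0 filterlim_inverse_at_top_right])
    then have r: "((\<lambda>y. (flat k y - flat k 0) / (y - 0)) \<longlongrightarrow> 0) (at_right 0)"
      by (rule Lim_transform_eventually)
        (auto simp: flat_def eventually_at_filter field_simps exp_minus power_inverse)
    have l: "((\<lambda>y. (flat k y - flat k 0) / (y - 0)) \<longlongrightarrow> 0) (at_left 0)"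
      by (rule Lim_transform_eventually[OF tendsto_const])
        (auto simp: flat_def eventually_at_filter)
    show ?thesis
      unfolding has_field_derivative_iff 3 using filterlim_split_at[OF l r] by (simp add: flat_def)
  qed
qed

text \<open>A class of smooth functions generated by atoms, so that smoothness to all orders reduces to
  closure under a single derivative, proved by rule induction.\<close>

inductive elem_smooth :: "(real \<Rightarrow> complex) \<Rightarrow> bool" where
  const: "elem_smooth (\<lambda>_. c)"
| ident: "elem_smooth (\<lambda>u. of_real u)"
| cis: "elem_smooth (\<lambda>u. cis (\<alpha> * u + \<beta>))"
| flat: "elem_smooth (\<lambda>u. of_real (flat k (\<alpha> * u + \<beta>)))"
| add: "elem_smooth f \<Longrightarrow> elem_smooth g \<Longrightarrow> elem_smooth (\<lambda>u. f u + g u)"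
| mult: "elem_smooth f \<Longrightarrow> elem_smooth g \<Longrightarrow> elem_smooth (\<lambda>u. f u * g u)"

lemma has_vector_derivative_cis_affine:
  "((\<lambda>u. cis (\<alpha> * u + \<beta>)) has_vector_derivative \<i> * of_real \<alpha> * cis (\<alpha> * x + \<beta>)) (at x within S)"
proof -
  have "((\<lambda>z. exp (\<i> * (of_real \<alpha> * z + of_real \<beta>))) has_field_derivative
      \<i> * of_real \<alpha> * exp (\<i> * (of_real \<alpha> * of_real x + of_real \<beta>))) (at (of_real x) within of_real ` S)"
    by (auto intro!: derivative_eq_intros)
  from field_vector_diff_chain_within[OF has_vector_derivative_of_real[OF DERIV_ident] this]
  show ?thesis by (simp add: o_def cis_conv_exp)
qed

lemma elem_smooth_derivative:
  assumes "elem_smooth f"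
  shows "\<exists>f'. elem_smooth f' \<and> (\<forall>x. (f has_vector_derivative f' x) (at x))"
  using assms
proof induction
  case (const c)
  show ?case by (intro exI[of _ "\<lambda>_. 0"]) (auto intro: elem_smooth.intros)
next
  case ident
  show ?case
    by (intro exI[of _ "\<lambda>_. 1"])
      (use has_vector_derivative_of_real[OF DERIV_ident] in \<open>auto intro: elem_smooth.intros\<close>)
next
  case (cis \<alpha> \<beta>)
  show ?case
    by (intro exI[of _ "\<lambda>u. \<i> * of_real \<alpha> * cis (\<alpha> * u + \<beta>)"] conjI allI)
      (auto intro: elem_smooth.intros has_vector_derivative_cis_affine)
next
  case (flat k \<alpha> \<beta>)
  \<comment> \<open>The minus sign sits inside a constant factor, so that
    \<open>elem_smooth.intros\<close> matches the derivative as it stands.\<close>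
  have "((\<lambda>u. complex_of_real (flat k (\<alpha> * u + \<beta>))) has_vector_derivative
      complex_of_real (flat (k + 2) (\<alpha> * x + \<beta>)) * of_real \<alpha> +
      complex_of_real (flat (k + 1) (\<alpha> * x + \<beta>)) * of_real (- \<alpha> * real k)) (at x)"
    (is "(_ has_vector_derivative ?f' x) _") for x
  proof -
    have "((\<lambda>u. flat k (\<alpha> * u + \<beta>)) has_real_derivative
        (flat (k + 2) (\<alpha> * x + \<beta>) - real k * flat (k + 1) (\<alpha> * x + \<beta>)) * \<alpha>) (at x)"
      by (rule DERIV_chain2[OF flat_has_real_derivative]) (auto intro!: derivative_eq_intros)
    from has_vector_derivative_of_real[OF this] show ?thesis
      by (rule has_vector_derivative_eq_rhs) (simp add: algebra_simps)
  qed
  then show ?case by (intro exI[of _ ?f'] conjI allI elem_smooth.intros)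
next
  case (add f g)
  then obtain f' g' where "elem_smooth f'" "\<forall>x. (f has_vector_derivative f' x) (at x)"
    "elem_smooth g'" "\<forall>x. (g has_vector_derivative g' x) (at x)" by blast
  then show ?case
    by (intro exI[of _ "\<lambda>x. f' x + g' x"])
      (auto intro: elem_smooth.intros has_vector_derivative_add)
next
  case (mult f g)
  then obtain f' g' where *: "elem_smooth f'" "\<forall>x. (f has_vector_derivative f' x) (at x)"
    "elem_smooth g'" "\<forall>x. (g has_vector_derivative g' x) (at x)" by blast
  then show ?case
    by (intro exI[of _ "\<lambda>x. f x * g' x + f' x * g x"])
      (auto intro!: elem_smooth.intros mult.hyps has_vector_derivative_mult)
qed

text \<open>These functions live on the frequency side: their inverse Fourier transforms will be the
  members of \<open>classP\<close> on which the multiplier is tested.\<close>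

definition test_fun :: "(real \<Rightarrow> complex) set" where
  "test_fun = {a. elem_smooth a \<and> (\<exists>R. \<forall>u. R < \<bar>u\<bar> \<longrightarrow> a u = 0)}"

lemma test_fun_continuous: "a \<in> test_fun \<Longrightarrow> continuous_on S a"
  unfolding test_fun_def
  by (blast dest: elem_smooth_derivative intro: continuous_at_imp_continuous_on has_vector_derivative_continuous)

lemma test_fun_measurable [measurable_dest]: "a \<in> test_fun \<Longrightarrow> a \<in> borel_measurable borel"
  by (intro borel_measurable_continuous_onI test_fun_continuous)

lemma test_fun_mult: "a \<in> test_fun \<Longrightarrow> elem_smooth f \<Longrightarrow> (\<lambda>u. f u * a u) \<in> test_fun"
  unfolding test_fun_def by (auto intro: elem_smooth.intros)

text \<open>Enlarging the radius makes \<open>a\<close> vanish at \<open>R\<close> and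
  \<open>-R\<close> as well, which later removes the boundary terms in integration by parts.\<close>

lemma test_fun_support:
  assumes "a \<in> test_fun"
  obtains R where "0 < R" "\<And>u. R \<le> \<bar>u\<bar> \<Longrightarrow> a u = 0"
proof -
  from assms obtain R where R: "\<And>u. R < \<bar>u\<bar> \<Longrightarrow> a u = 0" by (auto simp: test_fun_def)
  show ?thesis by (rule that[of "\<bar>R\<bar> + 1"]) (auto intro: R)
qed

lemma test_fun_derivative:
  assumes "a \<in> test_fun"
  obtains a' where "a' \<in> test_fun" "\<And>x. (a has_vector_derivative a' x) (at x)"
proof -
  obtain a' where a': "elem_smooth a'" "\<And>x. (a has_vector_derivative a' x) (at x)"
    using elem_smooth_derivative[of a] assms by (auto simp: test_fun_def)
  obtain R where R: "0 < R" "\<And>u. R \<le> \<bar>u\<bar> \<Longrightarrow> a u = 0" by (metis test_fun_support[OF assms])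
  have "a' u = 0" if "R < \<bar>u\<bar>" for u
  proof -
    have "(a has_vector_derivative 0) (at u)"
      by (rule has_vector_derivative_transform_within_open[of "\<lambda>_. 0" 0 u "{v. R < \<bar>v\<bar>}"])
        (use that R in \<open>auto intro!: open_Collect_less continuous_intros\<close>)
    then show ?thesis using a'(2) vector_derivative_unique_at by blast
  qed
  with a' show ?thesis by (intro that[of a']) (auto simp: test_fun_def)
qed

lemma test_fun_bounded:
  assumes "a \<in> test_fun"
  obtains K where "0 < K" "\<And>u. norm (a u) \<le> K"
proof -
  obtain R where R: "0 < R" "\<And>u. R \<le> \<bar>u\<bar> \<Longrightarrow> a u = 0" by (metis test_fun_support[OF assms])
  have "bounded (a ` {-R..R})"
    by (intro compact_imp_bounded compact_continuous_image test_fun_continuous assms) simp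
  then obtain K where K: "0 < K" "\<And>u. u \<in> {-R..R} \<Longrightarrow> norm (a u) \<le> K"
    by (auto simp: bounded_pos)
  have "norm (a u) \<le> K" for u
    using K R(2)[of u] by (cases "u \<in> {-R..R}") auto
  with K that show ?thesis by blast
qed

text \<open>This passes to the gauge integral over an interval, the setting of the Leibniz rule and
  of the fundamental theorem of calculus used below.\<close>

lemma supported_lborel:
  fixes f :: "real \<Rightarrow> complex"
  assumes "continuous_on UNIV f" and "\<And>u. R \<le> \<bar>u\<bar> \<Longrightarrow> f u = 0"
  shows "integrable lborel f" "integral\<^sup>L lborel f = integral {-R..R} f"
proof -
  have f: "f = (\<lambda>x. indicator {-R..R} x *\<^sub>R f x)"
    using assms(2) by (auto simp: fun_eq_iff indicator_def not_le abs_real_def)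
  have *: "set_integrable lborel {-R..R} f"
    unfolding set_integrable_def
    by (rule borel_integrable_compact) (auto intro: continuous_on_subset[OF assms(1)])
  then show "integrable lborel f" using f by (simp add: set_integrable_def)
  show "integral\<^sup>L lborel f = integral {-R..R} f"
    using set_borel_integral_eq_integral(2)[OF *] f by (simp add: set_lebesgue_integral_def)
qed

lemma test_fun_integrable: "a \<in> test_fun \<Longrightarrow> integrable lborel a"
  by (metis test_fun_support supported_lborel(1) test_fun_continuous)

section \<open>Inverse Fourier transforms of test functions are Schwartz functions\<close>

definition ifourier :: "(real \<Rightarrow> complex) \<Rightarrow> real \<Rightarrow> complex" where
  "ifourier a x = (LINT u|lborel. a u * cis (2 * pi * u * x))"

lemma borel_measurable_cis [measurable]: "cis \<in> borel_measurable borel"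
  by (intro borel_measurable_continuous_onI continuous_intros)

lemma integrable_cis_mult:
  assumes [measurable]: "integrable lborel (f :: real \<Rightarrow> complex)" "g \<in> borel_measurable borel"
  shows "integrable lborel (\<lambda>u. f u * cis (g u))"
  by (rule Bochner_Integration.integrable_bound[OF assms(1)]) (auto simp: norm_mult)

lemma norm_ifourier_le: "norm (ifourier a x) \<le> (LINT u|lborel. norm (a u))"
  unfolding ifourier_def by (rule order.trans[OF integral_norm_bound]) (simp add: norm_mult)

text \<open>Differentiation under the integral sign, over a fixed interval containing the support,
  where the differentiated integrand is jointly continuous.\<close>

lemma ifourier_has_vector_derivative:
  assumes "a \<in> test_fun"
  shows "(ifourier a has_vector_derivative ifourier (\<lambda>u. 2 * pi * \<i> * u * a u) x) (at x)"
proof -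
  obtain R where R: "0 < R" "\<And>u. R \<le> \<bar>u\<bar> \<Longrightarrow> a u = 0" by (metis test_fun_support[OF assms])
  have c [continuous_intros]: "continuous_on S a" for S by (rule test_fun_continuous[OF assms])
  have eq: "ifourier a = (\<lambda>x. integral (cbox (-R) R) (\<lambda>u. a u * cis (2 * pi * u * x)))"
    unfolding ifourier_def by (rule ext, simp, rule supported_lborel(2)) (auto intro!: continuous_intros simp: R)
  have eq': "ifourier (\<lambda>u. 2 * pi * \<i> * u * a u) x =
      integral (cbox (-R) R) (\<lambda>u. 2 * pi * \<i> * u * a u * cis (2 * pi * u * x))"
    unfolding ifourier_def by (simp, rule supported_lborel(2)) (auto intro!: continuous_intros simp: R)
  have a2: "continuous_on S (\<lambda>z. a (snd z))" for S :: "(real \<times> real) set"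
    by (rule continuous_on_compose2[OF c[of UNIV]]) (auto intro!: continuous_intros)
  show ?thesis
    unfolding eq eq'
  proof (rule leibniz_rule_vector_derivative[where U=UNIV])
    fix x u :: real
    \<comment> \<open>The kernel is written with \<open>+ 0\<close> to match the affine form in
      \<open>has_vector_derivative_cis_affine\<close>.\<close>
    have "((\<lambda>x. a u * cis ((2 * pi * u) * x + 0)) has_vector_derivative
       a u * (\<i> * of_real (2 * pi * u) * cis ((2 * pi * u) * x + 0))) (at x)"
      by (intro has_vector_derivative_mult_right has_vector_derivative_cis_affine)
    then show "((\<lambda>x. a u * cis (2 * pi * u * x)) has_vector_derivative
       2 * pi * \<i> * u * a u * cis (2 * pi * u * x)) (at x)"
      by (simp add: mult_ac)
  qed (auto intro!: continuous_intros integrable_continuous_real a2 simp: split_beta)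
qed

text \<open>Integration by parts: the derivative of \<open>a u * cis (2 * pi * u * x)\<close> in
  \<open>u\<close> integrates to 0, because \<open>a\<close> vanishes at both endpoints.\<close>

lemma ifourier_derivative:
  assumes "a \<in> test_fun" "a' \<in> test_fun" "\<And>x. (a has_vector_derivative a' x) (at x)"
  shows "ifourier a' x = - (2 * pi * \<i> * x) * ifourier a x"
proof -
  obtain R1 where R1: "0 < R1" "\<And>u. R1 \<le> \<bar>u\<bar> \<Longrightarrow> a u = 0" by (metis test_fun_support[OF assms(1)])
  obtain R2 where R2: "0 < R2" "\<And>u. R2 \<le> \<bar>u\<bar> \<Longrightarrow> a' u = 0" by (metis test_fun_support[OF assms(2)])
  define R where "R = max R1 R2"
  have R: "R \<le> \<bar>u\<bar> \<Longrightarrow> a u = 0" "R \<le> \<bar>u\<bar> \<Longrightarrow> a' u = 0" "0 < R" for u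
    using R1 R2 by (auto simp: R_def)
  note c [continuous_intros] = test_fun_continuous[OF assms(1)] test_fun_continuous[OF assms(2)]
  have "((\<lambda>u. a u * (\<i> * of_real (2 * pi * x) * cis ((2 * pi * x) * u + 0)) + a' u * cis ((2 * pi * x) * u + 0))
      has_integral a R * cis ((2 * pi * x) * R + 0) - a (-R) * cis ((2 * pi * x) * (-R) + 0)) {-R..R}"
    using \<open>0 < R\<close>
    by (intro fundamental_theorem_of_calculus has_vector_derivative_mult has_vector_derivative_cis_affine
       has_vector_derivative_at_within[OF assms(3)]) auto
  then have "((\<lambda>u. (2 * pi * \<i> * x) * (a u * cis (2 * pi * u * x)) + a' u * cis (2 * pi * u * x))
      has_integral 0) {-R..R}"
    by (simp add: R mult_ac)
  then have 1: "integral {-R..R} (\<lambda>u. (2 * pi * \<i> * x) * (a u * cis (2 * pi * u * x)) + a' u * cis (2 * pi * u * x)) = 0"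
    by (rule integral_unique)
  have "ifourier a x = integral {-R..R} (\<lambda>u. a u * cis (2 * pi * u * x))"
    unfolding ifourier_def by (rule supported_lborel(2)) (auto intro!: continuous_intros simp: R)
  moreover have "ifourier a' x = integral {-R..R} (\<lambda>u. a' u * cis (2 * pi * u * x))"
    unfolding ifourier_def by (rule supported_lborel(2)) (auto intro!: continuous_intros simp: R)
  moreover have "integral {-R..R} (\<lambda>u. (2 * pi * \<i> * x) * (a u * cis (2 * pi * u * x)) + a' u * cis (2 * pi * u * x))
     = (2 * pi * \<i> * x) * integral {-R..R} (\<lambda>u. a u * cis (2 * pi * u * x))
       + integral {-R..R} (\<lambda>u. a' u * cis (2 * pi * u * x))"
    by (subst integral_add) (auto intro!: integrable_continuous_real continuous_intros simp: integral_mult_right)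
  ultimately show ?thesis using 1 by (simp add: add_eq_0_iff)
qed

text \<open>Each factor \<open>x\<close> is traded for a derivative of \<open>a\<close>, so the
  induction must generalise over \<open>a\<close>; it ends at the trivial bound by the integral of
  the norm.\<close>

lemma ifourier_power_bounded:
  assumes "a \<in> test_fun"
  shows "bounded (range (\<lambda>x. complex_of_real (x ^ k) * ifourier a x))"
  using assms
proof (induction k arbitrary: a)
  case 0
  then show ?case by (auto intro!: boundedI norm_ifourier_le)
next
  case (Suc k)
  obtain a' where a': "a' \<in> test_fun" "\<And>x. (a has_vector_derivative a' x) (at x)"
    by (metis test_fun_derivative[OF Suc.prems])
  have "complex_of_real (x ^ Suc k) * ifourier a x = (- 1 / (2 * pi * \<i>)) * (complex_of_real (x ^ k) * ifourier a' x)" for x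
    by (subst ifourier_derivative[OF Suc.prems a']) (simp add: field_simps)
  then have eq: "range (\<lambda>x. complex_of_real (x ^ Suc k) * ifourier a x) =
      (\<lambda>z. (- 1 / (2 * pi * \<i>)) * z) ` range (\<lambda>x. complex_of_real (x ^ k) * ifourier a' x)"
    by (simp add: image_image)
  show ?case
    unfolding eq by (rule bounded_linear_image[OF Suc.IH[OF a'(1)] bounded_linear_mult_right])
qed

text \<open>Differentiating only multiplies the frequency side by a multiple of \<open>u\<close>, so
  every derivative inherits the decay just proved.\<close>

lemma nth_deriv_ifourier:
  assumes "a \<in> test_fun"
  shows "\<exists>c \<in> test_fun. nth_deriv n (ifourier a) = ifourier c"
proof (induction n)
  case 0
  show ?case using assms by (auto simp: nth_deriv_def)
next
  case (Suc n)
  then obtain c where c: "c \<in> test_fun" "nth_deriv n (ifourier a) = ifourier c" by blast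
  have "nth_deriv (Suc n) (ifourier a) = (\<lambda>x. vector_derivative (ifourier c) (at x))"
    using c(2) by (simp add: nth_deriv_def)
  also have "\<dots> = ifourier (\<lambda>u. 2 * pi * \<i> * u * c u)"
    by (intro ext vector_derivative_at ifourier_has_vector_derivative c)
  finally show ?case
    by (intro bexI[of _ "\<lambda>u. 2 * pi * \<i> * u * c u"]) (auto intro!: test_fun_mult elem_smooth.intros c)
qed

lemma schwartz_ifourier:
  assumes "a \<in> test_fun"
  shows "schwartz (ifourier a)"
  unfolding schwartz_def
proof (intro conjI allI)
  fix n k x
  obtain c where c: "c \<in> test_fun" "nth_deriv n (ifourier a) = ifourier c"
    using nth_deriv_ifourier[OF assms] by blast
  show "nth_deriv n (ifourier a) differentiable at x"
    unfolding c using ifourier_has_vector_derivative[OF c(1)] by (rule differentiableI_vector)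
  show "bounded (range (\<lambda>x. complex_of_real (x ^ k) * nth_deriv n (ifourier a) x))"
    unfolding c by (rule ifourier_power_bounded[OF c(1)])
qed

lemma ifourier_continuous: "a \<in> test_fun \<Longrightarrow> continuous_on S (ifourier a)"
  by (blast intro: continuous_at_imp_continuous_on has_vector_derivative_continuous ifourier_has_vector_derivative)

lemma ifourier_measurable [measurable_dest]: "a \<in> test_fun \<Longrightarrow> ifourier a \<in> borel_measurable borel"
  by (intro borel_measurable_continuous_onI ifourier_continuous)

text \<open>The bounds for the powers 0 and 2 add up to a majorant proportional to
  \<open>inverse (1 + x\<^sup>2)\<close>.\<close>

lemma integrable_ifourier:
  assumes "a \<in> test_fun"
  shows "integrable lborel (ifourier a)"
proof -
  obtain K0 where K0: "\<And>x. norm (complex_of_real (x ^ 0) * ifourier a x) \<le> K0"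
    using ifourier_power_bounded[OF assms, of 0] by (auto simp: bounded_iff)
  obtain K2 where K2: "\<And>x. norm (complex_of_real (x ^ 2) * ifourier a x) \<le> K2"
    using ifourier_power_bounded[OF assms, of 2] by (auto simp: bounded_iff)
  have "integrable lborel (\<lambda>x::real. inverse (1 + x\<^sup>2))"
    using integrable_inverse_1_plus_square by (simp add: set_integrable_def einterval_eq)
  then have "integrable lborel (\<lambda>x::real. (K0 + K2) * inverse (1 + x\<^sup>2))" by simp
  then show ?thesis
  proof (rule Bochner_Integration.integrable_bound)
    show "AE x in lborel. norm (ifourier a x) \<le> norm ((K0 + K2) * inverse (1 + x\<^sup>2))"
    proof (intro AE_I2)
      fix x :: real
      have p: "0 < 1 + x\<^sup>2" by (simp add: add_pos_nonneg)
      have "norm (ifourier a x) * (1 + x\<^sup>2) \<le> K0 + K2"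
        using K0[of x] K2[of x] by (simp add: norm_mult norm_power algebra_simps)
      then have "norm (ifourier a x) \<le> (K0 + K2) * inverse (1 + x\<^sup>2)"
        using p by (simp add: field_simps)
      then show "norm (ifourier a x) \<le> norm ((K0 + K2) * inverse (1 + x\<^sup>2))" by simp
    qed
  qed (use assms in measurable)
qed

section \<open>Fourier inversion for test functions\<close>

lemma integrable_pair_cis:
  fixes f g :: "real \<Rightarrow> complex"
  assumes f: "integrable lborel f" and g: "integrable lborel g"
    and [measurable]: "h \<in> borel_measurable (borel \<Otimes>\<^sub>M borel)"
  shows "integrable (lborel \<Otimes>\<^sub>M lborel) (\<lambda>(x, y). f x * g y * cis (h (x, y)))"
proof (rule lborel_pair.Fubini_integrable)
  note [measurable] = borel_measurable_integrable[OF f] borel_measurable_integrable[OF g]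
  show "(\<lambda>(x, y). f x * g y * cis (h (x, y))) \<in> borel_measurable (lborel \<Otimes>\<^sub>M lborel)"
    by measurable
  show "integrable lborel (\<lambda>x. LINT y|lborel. norm (case (x, y) of (x, y) \<Rightarrow> f x * g y * cis (h (x, y))))"
    using f by (simp add: norm_mult)
  show "AE x in lborel. integrable lborel (\<lambda>y. case (x, y) of (x, y) \<Rightarrow> f x * g y * cis (h (x, y)))"
    using g by (auto intro!: integrable_cis_mult)
qed

text \<open>The Gaussian reproduces itself under the Fourier transform; this is read off from the
  characteristic function of the standard normal distribution.\<close>

lemma LINT_std_normal_density_cis:
  "(LINT y|lborel. complex_of_real (std_normal_density y) * cis (t * y)) =
    of_real (sqrt (2 * pi) * std_normal_density t)"
proof -
  have "(LINT y|lborel. complex_of_real (std_normal_density y) * cis (t * y)) = char std_normal_distribution t"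
    unfolding char_def
    by (subst integral_density) (auto simp: cis_conv_exp scaleR_conv_of_real)
  also have "\<dots> = of_real (sqrt (2 * pi) * std_normal_density t)"
    unfolding char_std_normal_distribution by (simp add: std_normal_density_def)
  finally show ?thesis .
qed

text \<open>Gaussian regularisation. The damped integrals \<open>I n\<close> converge to the left
  side; by Fubini they are also averages of \<open>a\<close> against Gaussians concentrating at
  \<open>u\<close>, so they converge to \<open>a u\<close>.\<close>

lemma fourier_ifourier:
  assumes a: "a \<in> test_fun"
  shows "fourier (ifourier a) = a"
proof
  fix u
  let ?d = std_normal_density
  define N where "N n = real (Suc n)" for n
  have N: "0 < N n" for n by (simp add: N_def)
  \<comment> \<open>The factor \<open>sqrt (2 * pi)\<close> cancels the normalisation of the
    density, so the damping is at most 1 and tends to 1 pointwise.\<close>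
  define I where "I n = (LINT x|lborel. ifourier a x * cis (- 2 * pi * x * u) * of_real (sqrt (2 * pi) * ?d (x / N n)))" for n
  note [measurable] = test_fun_measurable[OF a] ifourier_measurable[OF a]
  have d_le: "\<bar>sqrt (2 * pi) * ?d x\<bar> \<le> 1" for x
    by (simp add: std_normal_density_def abs_mult)
  have Ninf: "(\<lambda>n. x / N n) \<longlonglongrightarrow> 0" for x
    unfolding N_def using LIMSEQ_Suc[OF lim_const_over_n[of x]] by simp
  have "I \<longlonglongrightarrow> fourier (ifourier a) u"
    unfolding I_def fourier_def
  proof (rule integral_dominated_convergence[where w="\<lambda>x. norm (ifourier a x)"])
    show "AE x in lborel. (\<lambda>n. ifourier a x * cis (- 2 * pi * x * u) * of_real (sqrt (2 * pi) * ?d (x / N n)))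
        \<longlonglongrightarrow> ifourier a x * cis (- 2 * pi * x * u)"
    proof (intro AE_I2)
      fix x
      have "(\<lambda>n. ifourier a x * cis (- 2 * pi * x * u) * of_real (exp (- (x / N n)\<^sup>2 / 2)))
        \<longlonglongrightarrow> ifourier a x * cis (- 2 * pi * x * u) * of_real (exp (- 0\<^sup>2 / 2))"
        by (intro tendsto_intros Ninf) simp
      then show "(\<lambda>n. ifourier a x * cis (- 2 * pi * x * u) * of_real (sqrt (2 * pi) * ?d (x / N n)))
        \<longlonglongrightarrow> ifourier a x * cis (- 2 * pi * x * u)"
        by (simp add: std_normal_density_def)
    qed
    show "AE x in lborel. norm (ifourier a x * cis (- 2 * pi * x * u) * of_real (sqrt (2 * pi) * ?d (x / N n)))
        \<le> norm (ifourier a x)" for n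
      using d_le by (intro AE_I2) (simp only: norm_mult norm_cis norm_of_real mult_1_right, rule mult_left_le, auto)
  qed (auto intro!: integrable_norm integrable_ifourier[OF a])
  moreover have "I = (\<lambda>n. LINT z|lborel. a (u + z / (2 * pi * N n)) * of_real (?d z))"
  proof
    fix n
    let ?F = "\<lambda>x v. of_real (sqrt (2 * pi) * ?d (x / N n)) * a v * cis (2 * pi * (v - u) * x)"
    have cis: "cis (2 * pi * (v - u) * x) = cis (2 * pi * v * x) * cis (- 2 * pi * x * u)" for v x
      by (simp add: cis_mult algebra_simps)
    have "I n = (LINT x|lborel. LINT v|lborel. ?F x v)"
      unfolding I_def ifourier_def cis
      by (intro Bochner_Integration.integral_cong refl)
        (simp add: mult_ac flip: integral_mult_left_zero integral_mult_right_zero)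
    also have "\<dots> = (LINT v|lborel. LINT x|lborel. ?F x v)"
    proof (rule lborel_pair.Fubini_integral[symmetric])
      have "integrable lborel (\<lambda>x. ?d (0 + (1 / N n) * x))"
        by (rule lborel_integrable_real_affine) (use N in \<open>auto simp: less_imp_neq[symmetric]\<close>)
      then have "integrable lborel (\<lambda>x. complex_of_real (sqrt (2 * pi) * ?d (x / N n)))"
        by (auto intro!: integrable_of_real)
      then show "integrable (lborel \<Otimes>\<^sub>M lborel) (\<lambda>(x, v). ?F x v)"
        using integrable_pair_cis[of "\<lambda>x. complex_of_real (sqrt (2 * pi) * ?d (x / N n))" a
            "\<lambda>(x, v). 2 * pi * (v - u) * x"] test_fun_integrable[OF a] by simp
    qed
    also have "\<dots> = (LINT v|lborel. of_real (2 * pi * N n) * (a v * of_real (?d (2 * pi * N n * (v - u)))))"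
    proof (intro Bochner_Integration.integral_cong refl)
      fix v
      have "(LINT x|lborel. ?F x v) = N n *\<^sub>R (LINT x|lborel. ?F (0 + N n * x) v)"
        using N[of n] lborel_integral_real_affine[of "N n" "\<lambda>x. ?F x v" 0] by simp
      also have "\<dots> = N n * (sqrt (2 * pi) * a v * (LINT x|lborel. of_real (?d x) * cis (2 * pi * (v - u) * N n * x)))"
        using N[of n] by (simp add: scaleR_conv_of_real mult_ac flip: integral_mult_right_zero)
      also have "\<dots> = of_real (2 * pi * N n) * (a v * of_real (?d (2 * pi * N n * (v - u))))"
        unfolding LINT_std_normal_density_cis
        by (simp add: mult_ac flip: of_real_mult)
      finally show "(LINT x|lborel. ?F x v) = \<dots>" .
    qed
    \<comment> \<open>Rescaling about \<open>u\<close> freezes the Gaussian and leaves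
      \<open>n\<close> only in the argument of the bounded function \<open>a\<close>, which gives a
      majorant independent of \<open>n\<close>.\<close>
    also have "\<dots> = (1 / (2 * pi * N n)) *\<^sub>R (LINT z|lborel. of_real (2 * pi * N n) *
        (a (u + 1 / (2 * pi * N n) * z) * of_real (?d (2 * pi * N n * (u + 1 / (2 * pi * N n) * z - u)))))"
      using N[of n] by (subst lborel_integral_real_affine[where c="1 / (2 * pi * N n)" and t=u]) auto
    also have "\<dots> = (LINT z|lborel. a (u + z / (2 * pi * N n)) * of_real (?d z))"
      using N[of n] by (simp add: scaleR_conv_of_real)
    finally show "I n = \<dots>" .
  qed
  moreover have "(\<lambda>n. LINT z|lborel. a (u + z / (2 * pi * N n)) * of_real (?d z))
      \<longlonglongrightarrow> (LINT z|lborel. a u * of_real (?d z))"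
  proof -
    obtain K where K: "0 < K" "\<And>u. norm (a u) \<le> K" by (metis test_fun_bounded[OF a])
    show ?thesis
    proof (rule integral_dominated_convergence[where w="\<lambda>z. K * ?d z"])
      show "AE z in lborel. (\<lambda>n. a (u + z / (2 * pi * N n)) * of_real (?d z)) \<longlonglongrightarrow> a u * of_real (?d z)"
      proof (intro AE_I2 tendsto_intros)
        fix z
        have "(\<lambda>n. u + z / (2 * pi) / N n) \<longlonglongrightarrow> u + 0"
          by (intro tendsto_intros Ninf)
        then show "(\<lambda>n. a (u + z / (2 * pi * N n))) \<longlonglongrightarrow> a u"
          using continuous_on_tendsto_compose[OF test_fun_continuous[OF a, of UNIV]] by simp
      qed
      show "AE z in lborel. norm (a (u + z / (2 * pi * N n)) * of_real (?d z)) \<le> K * ?d z" for n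
        using K by (auto simp: norm_mult intro!: mult_right_mono)
    qed (auto intro!: integrable_mult_right)
  qed
  moreover have "(LINT z|lborel. a u * of_real (?d z)) = a u"
    by (simp flip: of_real_mult)
  ultimately show "fourier (ifourier a) u = a u"
    using LIMSEQ_unique by metis
qed

lemma ifourier_in_classP:
  assumes "a \<in> test_fun"
  shows "ifourier a \<in> classP"
proof -
  obtain R where R: "0 < R" "\<And>u. R \<le> \<bar>u\<bar> \<Longrightarrow> a u = 0" by (metis test_fun_support[OF assms])
  have "{u. a u \<noteq> 0} \<subseteq> cball 0 R" using R(2) by (force simp: not_le)
  then have "bounded {u. a u \<noteq> 0}" by (rule bounded_subset[OF bounded_cball])
  then show ?thesis
    unfolding classP_def
    by (auto simp: fourier_ifourier assms schwartz_ifourier test_fun_continuous compact_closure)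
qed

text \<open>The affine arguments built into the atoms \<open>cis\<close> and \<open>flat\<close>
  absorb the substitution, so no composition rule is called for.\<close>

lemma elem_smooth_affine:
  assumes "elem_smooth f"
  shows "elem_smooth (\<lambda>u. f (c * u + d))"
  using assms
proof induction
  case ident
  have "elem_smooth (\<lambda>u. of_real c * of_real u + of_real d)" by (intro elem_smooth.intros)
  then show ?case by simp
next
  case (cis \<alpha> \<beta>)
  have "elem_smooth (\<lambda>u. cis ((\<alpha> * c) * u + (\<alpha> * d + \<beta>)))" by (rule elem_smooth.cis)
  then show ?case by (simp add: algebra_simps)
next
  case (flat k \<alpha> \<beta>)
  have "elem_smooth (\<lambda>u. of_real (flat k ((\<alpha> * c) * u + (\<alpha> * d + \<beta>))))" by (rule elem_smooth.flat)
  then show ?case by (simp add: algebra_simps)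
qed (auto intro: elem_smooth.intros)

lemma test_fun_affine:
  assumes "a \<in> test_fun" "c \<noteq> 0"
  shows "(\<lambda>u. a (c * u + d)) \<in> test_fun"
proof -
  obtain R where R: "0 < R" "\<And>u. R \<le> \<bar>u\<bar> \<Longrightarrow> a u = 0" by (metis test_fun_support[OF assms(1)])
  have "a (c * u + d) = 0" if "(R + \<bar>d\<bar>) / \<bar>c\<bar> < \<bar>u\<bar>" for u
  proof (rule R(2))
    have "R + \<bar>d\<bar> < \<bar>c * u\<bar>" using that assms(2) by (simp add: field_simps abs_mult)
    then show "R \<le> \<bar>c * u + d\<bar>" by linarith
  qed
  with assms(1) show ?thesis by (auto simp: test_fun_def intro: elem_smooth_affine)
qed

section \<open>A bump function and its integrals\<close>

definition bump :: "real \<Rightarrow> real" where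
  "bump u = flat 0 (1 + u) * flat 0 (1 - u)"

lemma flat_0_bounds: "0 \<le> flat 0 x" "flat 0 x \<le> 1" "0 < x \<Longrightarrow> 0 < flat 0 x"
  by (auto simp: flat_def)

lemma bump_nonneg: "0 \<le> bump u"
  and bump_le_1: "bump u \<le> 1"
  and bump_pos: "\<bar>u\<bar> < 1 \<Longrightarrow> 0 < bump u"
  and bump_eq_0: "1 \<le> \<bar>u\<bar> \<Longrightarrow> bump u = 0"
  unfolding bump_def by (auto intro!: flat_0_bounds mult_le_one mult_nonneg_nonneg mult_pos_pos)
    (auto simp: flat_def abs_real_def split: if_splits)

lemma bump_test_fun: "(\<lambda>u. of_real (bump u)) \<in> test_fun"
proof -
  have "elem_smooth (\<lambda>u. of_real (flat 0 (1 * u + 1)) * of_real (flat 0 ((-1) * u + 1)))"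
    by (intro elem_smooth.intros)
  then show ?thesis
    by (auto simp: test_fun_def bump_def[abs_def] add.commute intro!: exI[of _ 1])
      (auto simp: flat_def abs_real_def split: if_splits)
qed

lemma bump_continuous [continuous_intros]: "continuous_on S f \<Longrightarrow> continuous_on S (\<lambda>u. bump (f u))"
proof -
  have "continuous_on UNIV (\<lambda>u. Re (of_real (bump u)))"
    by (intro continuous_intros test_fun_continuous bump_test_fun)
  then have "continuous_on UNIV bump" by simp
  then show "continuous_on S f \<Longrightarrow> continuous_on S (\<lambda>u. bump (f u))"
    by (rule continuous_on_compose2) auto
qed

lemma bump_measurable [measurable]: "bump \<in> borel_measurable borel"
  by (intro borel_measurable_continuous_onI continuous_intros)

lemma bump_integrable: "integrable lborel bump"
  using integrable_Re[OF test_fun_integrable[OF bump_test_fun]] by simp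

text \<open>The first and second powers give the values at 0 of the transforms in the two limit
  functions, which must not vanish there.\<close>

lemma bump_power_integral_pos:
  shows "integrable lborel (\<lambda>u. bump u ^ Suc k)" "0 < (LINT u|lborel. bump u ^ Suc k)"
proof -
  show *: "integrable lborel (\<lambda>u. bump u ^ Suc k)"
    by (rule Bochner_Integration.integrable_bound[OF bump_integrable])
      (auto simp: bump_nonneg bump_le_1 power_le_one intro!: mult_left_le)
  have "(LINT u|lborel. bump u ^ Suc k) \<noteq> 0"
  proof
    assume "(LINT u|lborel. bump u ^ Suc k) = 0"
    then have "AE u in lborel. bump u ^ Suc k = 0"
      using integral_nonneg_eq_0_iff_AE[OF *] bump_nonneg by simp
    then have "AE u in lborel. u \<notin> {-1<..<1::real}"
      by (rule eventually_mono) (use bump_pos in \<open>force simp: abs_less_iff\<close>)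
    then have "{-1<..<1::real} \<in> null_sets lborel"
      by (subst AE_iff_null_sets) auto
    then show False by (simp add: null_sets_def)
  qed
  moreover have "0 \<le> (LINT u|lborel. bump u ^ Suc k)"
    by (intro integral_nonneg_AE) (simp add: bump_nonneg)
  ultimately show "0 < (LINT u|lborel. bump u ^ Suc k)" by simp
qed

section \<open>Lebesgue norms\<close>

lemma lp_norm_infinity: "lp_norm \<infinity> f = esssup lborel (\<lambda>x. ennreal (norm (f x)))"
  by (simp add: lp_norm_def)

lemma lp_norm_ereal:
  "lp_norm (ereal r) f =
    (if (\<integral>\<^sup>+ x. ennreal (norm (f x) powr r) \<partial>lborel) = \<infinity> then \<infinity>
     else ennreal (enn2real (\<integral>\<^sup>+ x. ennreal (norm (f x) powr r) \<partial>lborel) powr (1 / r)))"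
  by (simp add: lp_norm_def Let_def)

lemma lp_norm_cong: "(\<And>x. norm (f x) = norm (g x)) \<Longrightarrow> lp_norm p f = lp_norm p g"
  by (simp add: lp_norm_def)

text \<open>Nondegenerate affine maps preserve null sets; this serves the case
  \<open>p = \<infinity>\<close> of the scaling law.\<close>

lemma AE_lborel_affine:
  fixes c t :: real
  assumes "AE x in lborel. P x" "c \<noteq> 0" and [measurable]: "Measurable.pred borel P"
  shows "AE x in lborel. P (t + c * x)"
proof -
  have "AE x in density (distr lborel borel (\<lambda>x. t + c * x)) (\<lambda>_. ennreal \<bar>c\<bar>). P x"
    using assms(1) lborel_real_affine[OF assms(2), of t] by metis
  then have "AE x in distr lborel borel (\<lambda>x. t + c * x). P x"
    using assms(2) by (simp add: AE_density)
  then show ?thesis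
    by (subst (asm) AE_distr_iff) auto
qed

text \<open>A change of variables in the integral. Since \<open>1 / \<infinity>\<close> is 0, one
  exponent covers all \<open>p\<close>, and an inequality is enough because it can be applied with
  \<open>l\<close> as well as with \<open>1 / l\<close>.\<close>

lemma lp_norm_affine_le:
  assumes [measurable]: "F \<in> borel_measurable borel" and l: "0 < l" and p: "0 < p"
  shows "lp_norm p (\<lambda>x. F (t + l * x)) \<le> ennreal (l powr - real_of_ereal (1 / p)) * lp_norm p F"
proof (cases p)
  case PInf
  have "AE x in lborel. ennreal (norm (F x)) \<le> esssup lborel (\<lambda>x. ennreal (norm (F x)))"
    by (rule esssup_AE)
  then have "AE x in lborel. ennreal (norm (F (t + l * x))) \<le> esssup lborel (\<lambda>x. ennreal (norm (F x)))"
    by (rule AE_lborel_affine) (use l in auto)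
  then show ?thesis
    using l by (simp add: PInf lp_norm_infinity esssup_I)
next
  case (real r)
  with p have r: "0 < r" by simp
  let ?I = "\<integral>\<^sup>+ x. ennreal (norm (F x) powr r) \<partial>lborel"
  let ?J = "\<integral>\<^sup>+ x. ennreal (norm (F (t + l * x)) powr r) \<partial>lborel"
  have IJ: "?I = ennreal l * ?J"
    using l by (subst nn_integral_real_affine[of _ l t]) auto
  show ?thesis
  proof (cases "?I = \<infinity>")
    case True
    then show ?thesis using l by (simp add: real lp_norm_ereal ennreal_mult_top)
  next
    case False
    then have "?J \<noteq> \<infinity>" using IJ l by (auto simp: ennreal_mult_top)
    then obtain j where j: "?J = ennreal j" "0 \<le> j" by (cases ?J) auto
    have i: "?I = ennreal (l * j)" using IJ j l by (simp add: ennreal_mult)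
    have "j powr (1 / r) = l powr - (1 / r) * (l * j) powr (1 / r)"
      using l j by (simp add: powr_mult powr_minus field_simps)
    then show ?thesis
      using r j l by (simp add: real lp_norm_ereal i one_ereal_def flip: ennreal_mult)
  qed
qed (use p in simp)

lemma lp_norm_cmult_le:
  assumes [measurable]: "F \<in> borel_measurable borel" and c: "0 < c" and p: "0 < p"
  shows "lp_norm p (\<lambda>x. of_real c * F x) \<le> ennreal c * lp_norm p F"
proof (cases p)
  case PInf
  have "AE x in lborel. ennreal (norm (F x)) \<le> esssup lborel (\<lambda>x. ennreal (norm (F x)))"
    by (rule esssup_AE)
  then have "AE x in lborel. ennreal (norm (of_real c * F x)) \<le> ennreal c * esssup lborel (\<lambda>x. ennreal (norm (F x)))"
    by eventually_elim (use c in \<open>simp add: norm_mult ennreal_mult mult_left_mono\<close>)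
  then show ?thesis
    using c by (simp add: PInf lp_norm_infinity esssup_I)
next
  case (real r)
  with p have r: "0 < r" by simp
  let ?I = "\<integral>\<^sup>+ x. ennreal (norm (F x) powr r) \<partial>lborel"
  let ?J = "\<integral>\<^sup>+ x. ennreal (norm (of_real c * F x) powr r) \<partial>lborel"
  have IJ: "?J = ennreal (c powr r) * ?I"
    using c by (simp add: norm_mult powr_mult ennreal_mult nn_integral_cmult)
  show ?thesis
  proof (cases "?I = \<infinity>")
    case True
    then show ?thesis using c by (simp add: real lp_norm_ereal ennreal_mult_top)
  next
    case False
    then obtain i where i: "?I = ennreal i" "0 \<le> i" by (cases ?I) auto
    have j: "?J = ennreal (c powr r * i)" using IJ i by (simp add: ennreal_mult)
    have "(c powr r * i) powr (1 / r) = c * i powr (1 / r)"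
      using c i r by (simp add: powr_mult powr_powr)
    then show ?thesis
      unfolding real lp_norm_ereal i j using c i
      by (simp flip: ennreal_mult)
  qed
qed (use p in simp)

lemma lp_norm_finite:
  assumes F: "integrable lborel F" and K: "\<And>x. norm (F x) \<le> K" and p: "1 \<le> p"
  shows "lp_norm p F < \<infinity>"
proof (cases p)
  case PInf
  have "esssup lborel (\<lambda>x. ennreal (norm (F x))) \<le> ennreal K"
    using borel_measurable_integrable[OF F] K by (intro esssup_I) (auto intro: ennreal_leI)
  then show ?thesis by (simp add: PInf lp_norm_infinity order_le_less_trans)
next
  case (real r)
  with p have r: "1 \<le> r" by simp
  \<comment> \<open>Interpolation between integrability and boundedness: all but one power of the
    norm is estimated by \<open>K\<close>.\<close>
  have "norm (F x) powr r \<le> norm (F x) * K powr (r - 1)" for x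
  proof -
    have "norm (F x) powr r = norm (F x) * norm (F x) powr (r - 1)"
      using r by (cases "F x = 0") (simp_all add: powr_mult_base)
    also have "\<dots> \<le> norm (F x) * K powr (r - 1)"
      using r K by (intro mult_left_mono powr_mono2) auto
    finally show ?thesis .
  qed
  then have "(\<integral>\<^sup>+ x. ennreal (norm (F x) powr r) \<partial>lborel) \<le> (\<integral>\<^sup>+ x. ennreal (norm (F x) * K powr (r - 1)) \<partial>lborel)"
    by (intro nn_integral_mono ennreal_leI)
  also have "\<dots> < \<infinity>"
    using integrable_mult_left[OF integrable_norm[OF F], of "K powr (r - 1)"]
    unfolding integrable_iff_bounded by simp
  finally show ?thesis by (auto simp: real lp_norm_ereal)
qed (use p in simp)

text \<open>Fatou's lemma on a small interval around \<open>0\<close>; there the \<open>L\<^sup>\<infinity>\<close> norm dominates the \<open>L\<^sup>1\<close> norm.\<close>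

lemma lp_norm_eventually_bounded_below:
  assumes [measurable]: "\<And>n. F n \<in> borel_measurable borel"
    and lim: "\<And>y. (\<lambda>n. F n y) \<longlonglongrightarrow> G y"
    and G: "continuous_on UNIV G" "G 0 \<noteq> 0" and p: "0 < p"
  obtains c :: real where "0 < c" "eventually (\<lambda>n. ennreal c \<le> lp_norm p (F n)) sequentially"
proof -
  define q where "q = (if p = \<infinity> then 1 else real_of_ereal p)"
  have q: "0 < q" using p by (cases p) (auto simp: q_def)
  define g where "g = norm (G 0) / 2"
  have g: "0 < g" using G(2) by (simp add: g_def)
  have "((\<lambda>y. norm (G y)) \<longlongrightarrow> norm (G 0)) (at 0)"
    using G(1) by (intro tendsto_norm) (simp add: continuous_on_eq_continuous_at isCont_def)
  then have "eventually (\<lambda>y. g < norm (G y)) (at 0)"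
    by (rule order_tendstoD) (use g in \<open>simp add: g_def\<close>)
  then obtain d where d: "0 < d" "\<And>y. y \<noteq> 0 \<Longrightarrow> \<bar>y\<bar> < d \<Longrightarrow> g < norm (G y)"
    by (auto simp: eventually_at dist_real_def)
  have gG: "g \<le> norm (G y)" if "y \<in> {-d<..<d}" for y
    using that d(2)[of y] g by (cases "y = 0") (auto simp: g_def abs_less_iff)
  define J where "J n = (\<integral>\<^sup>+ y. ennreal (norm (F n y) powr q) * indicator {-d<..<d} y \<partial>lborel)" for n
  \<comment> \<open>The interval has length \<open>2 * d\<close>; keeping only \<open>d\<close>
    makes the inequality strict, as \<open>less_LiminfD\<close> demands.\<close>
  have "ennreal (g powr q * d) < ennreal (g powr q) * ennreal (2 * d)"
    using g d(1) by (simp add: ennreal_less_iff flip: ennreal_mult)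
  also have "\<dots> = (\<integral>\<^sup>+ y. ennreal (g powr q) * indicator {-d<..<d} y \<partial>lborel)"
    using d(1) by (simp add: nn_integral_cmult)
  also have "\<dots> \<le> (\<integral>\<^sup>+ y. liminf (\<lambda>n. ennreal (norm (F n y) powr q) * indicator {-d<..<d} y) \<partial>lborel)"
  proof (rule nn_integral_mono)
    fix y
    have "(\<lambda>n. ennreal (norm (F n y) powr q)) \<longlonglongrightarrow> ennreal (norm (G y) powr q)"
      by (intro tendsto_ennrealI tendsto_powr' tendsto_norm lim tendsto_const) (use q in auto)
    then have "liminf (\<lambda>n. ennreal (norm (F n y) powr q)) = ennreal (norm (G y) powr q)"
      by (intro lim_imp_Liminf) auto
    then show "ennreal (g powr q) * indicator {-d<..<d} y
        \<le> liminf (\<lambda>n. ennreal (norm (F n y) powr q) * indicator {-d<..<d} y)"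
      using gG[of y] g q by (cases "y \<in> {-d<..<d}") (auto intro!: ennreal_leI powr_mono2)
  qed
  also have "\<dots> \<le> liminf J"
    unfolding J_def by (rule nn_integral_liminf) measurable
  finally have ev: "eventually (\<lambda>n. ennreal (g powr q * d) < J n) sequentially"
    by (rule less_LiminfD)
  show thesis
  proof (cases p)
    case PInf
    show thesis
    proof (rule that)
      \<comment> \<open>Here \<open>q = 1\<close>: the integral exceeds \<open>g * d\<close> but is
        at most \<open>2 * d\<close> times the essential supremum, whence the half.\<close>
      show "0 < g / 2" using g by simp
      show "eventually (\<lambda>n. ennreal (g / 2) \<le> lp_norm p (F n)) sequentially"
        using ev
      proof eventually_elim
        case (elim n)
        let ?E = "esssup lborel (\<lambda>x. ennreal (norm (F n x)))"
        have "ennreal (2 * d) * ennreal (g / 2) = ennreal (g powr q * d)"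
          using g d(1) by (simp add: q_def PInf flip: ennreal_mult)
        also have "\<dots> \<le> J n" using elim by simp
        also have "\<dots> \<le> (\<integral>\<^sup>+ y. ?E * indicator {-d<..<d} y \<partial>lborel)"
          unfolding J_def
          by (intro nn_integral_mono_AE eventually_mono[OF esssup_AE[where M=lborel and f="\<lambda>x. ennreal (norm (F n x))"]])
            (simp add: q_def PInf mult_right_mono)
        also have "\<dots> = ?E * ennreal (2 * d)"
          using d(1) by (simp add: nn_integral_cmult)
        also have "\<dots> = ennreal (2 * d) * ?E"
          by (rule mult.commute)
        finally have "ennreal (g / 2) \<le> ?E"
          by (rule iffD1[OF ennreal_mult_le_mult_iff, rotated 2]) (use d(1) in auto)
        then show ?case by (simp add: PInf lp_norm_infinity)
      qed
    qed
  next
    case (real r)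
    then have r: "q = r" by (simp add: q_def)
    show thesis
    proof (rule that)
      show "0 < (g powr q * d) powr (1 / q)" using g d(1) by simp
      show "eventually (\<lambda>n. ennreal ((g powr q * d) powr (1 / q)) \<le> lp_norm p (F n)) sequentially"
        using ev
      proof eventually_elim
        case (elim n)
        let ?I = "\<integral>\<^sup>+ x. ennreal (norm (F n x) powr r) \<partial>lborel"
        have "J n \<le> ?I"
          unfolding J_def r by (intro nn_integral_mono) (auto split: split_indicator)
        with elim have I: "ennreal (g powr q * d) \<le> ?I" by simp
        show ?case
        proof (cases ?I)
          case (real i)
          with I g d(1) have "g powr q * d \<le> i" by (simp add: ennreal_le_iff)
          with real g d(1) q show ?thesis
            unfolding \<open>p = ereal r\<close> lp_norm_ereal
            by (auto simp: r intro!: ennreal_leI powr_mono2)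
        next
          case top
          then show ?thesis by (simp add: \<open>p = ereal r\<close> lp_norm_ereal)
        qed
      qed
    qed
  qed (use p in simp)
qed

section \<open>Dilated bumps\<close>

abbreviation phi :: "real \<Rightarrow> complex" where
  "phi \<equiv> ifourier (\<lambda>u. of_real (bump u))"

text \<open>The factor \<open>1 / l\<close> makes the inverse transform, up to a phase, exactly
  \<open>phi\<close> dilated by \<open>l\<close> and centred at \<open>s\<close>, with no loss of
  height.\<close>

definition wave :: "real \<Rightarrow> real \<Rightarrow> real \<Rightarrow> real \<Rightarrow> complex" where
  "wave s a l \<xi> = of_real (1 / l) * cis (- 2 * pi * s * (\<xi> - a)) * of_real (bump ((\<xi> - a) / l))"

lemma wave_test_fun:
  assumes "0 < l"
  shows "wave s a l \<in> test_fun"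
proof -
  have "(\<lambda>\<xi>. (of_real (1 / l) * cis ((- 2 * pi * s) * \<xi> + 2 * pi * s * a)) * of_real (bump (1 / l * \<xi> + (- a / l)))) \<in> test_fun"
    using assms by (intro test_fun_mult test_fun_affine[OF bump_test_fun] elem_smooth.intros) auto
  then show ?thesis
    by (simp add: wave_def[abs_def] algebra_simps diff_divide_distrib)
qed

lemma norm_ifourier_wave:
  assumes "0 < l"
  shows "norm (ifourier (wave s a l) x) = norm (phi (- l * s + l * x))"
proof -
  have "ifourier (wave s a l) x = l *\<^sub>R (LINT u|lborel. wave s a l (a + l * u) * cis (2 * pi * (a + l * u) * x))"
    unfolding ifourier_def using assms by (subst lborel_integral_real_affine[where c=l and t=a]) auto
  also have "\<dots> = (LINT u|lborel. cis (2 * pi * a * x) * (of_real (bump u) * cis (2 * pi * u * (- l * s + l * x))))"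
    unfolding integral_scaleR_right[symmetric]
  proof (rule Bochner_Integration.integral_cong[OF refl])
    fix u
    have "cis (- 2 * pi * s * (l * u)) * cis (2 * pi * (a + l * u) * x) =
        cis (2 * pi * a * x) * cis (2 * pi * u * (- l * s + l * x))"
      by (simp add: cis_mult algebra_simps)
    then show "l *\<^sub>R (wave s a l (a + l * u) * cis (2 * pi * (a + l * u) * x)) =
        cis (2 * pi * a * x) * (of_real (bump u) * cis (2 * pi * u * (- l * s + l * x)))"
      using assms by (simp add: wave_def scaleR_conv_of_real mult_ac)
  qed
  finally show ?thesis
    by (simp add: ifourier_def norm_mult)
qed

text \<open>By Fourier inversion this is \<open>bilin_op N phi phi\<close>, written without
  \<open>fourier\<close> for the passage to the limit.\<close>

definition bump_form :: "(real \<Rightarrow> complex) \<Rightarrow> real \<Rightarrow> complex" where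
  "bump_form N y = (LINT v|lborel. LINT u|lborel.
     of_real (bump u * bump v) * N (u - v) * cis (2 * pi * (u + v) * y))"

lemma bump_form_measurable [measurable]:
  assumes [measurable]: "N \<in> borel_measurable borel"
  shows "bump_form N \<in> borel_measurable borel"
  unfolding bump_form_def by measurable

text \<open>Opposite modulations \<open>s\<close> and \<open>- s\<close> combine into a phase in
  \<open>u - v\<close> alone, so it can be absorbed into the symbol; the centre \<open>a\<close> of
  the first bump shifts the symbol. The Jacobian \<open>l * l\<close> cancels the two factors
  \<open>1 / l\<close>.\<close>

lemma bilin_op_wave:
  assumes "0 < l"
  shows "bilin_op M (ifourier (wave s a l)) (ifourier (wave (- s) 0 l)) x =
    cis (2 * pi * a * x) * bump_form (\<lambda>t. cis (- 2 * pi * s * l * t) * M (a + l * t)) (l * x)"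
proof -
  let ?B = "\<lambda>\<xi> \<eta>. wave s a l \<xi> * wave (- s) 0 l \<eta> * M (\<xi> - \<eta>) * cis (2 * pi * (\<xi> + \<eta>) * x)"
  have "bilin_op M (ifourier (wave s a l)) (ifourier (wave (- s) 0 l)) x =
      (LINT \<eta>|lborel. LINT \<xi>|lborel. ?B \<xi> \<eta>)"
    unfolding bilin_op_def by (simp add: fourier_ifourier wave_test_fun assms)
  also have "\<dots> = l *\<^sub>R (LINT v|lborel. LINT \<xi>|lborel. ?B \<xi> (0 + l * v))"
    using assms by (subst lborel_integral_real_affine[where c=l and t=0]) auto
  also have "\<dots> = l *\<^sub>R (LINT v|lborel. l *\<^sub>R (LINT u|lborel. ?B (a + l * u) (0 + l * v)))"
    using assms by (subst lborel_integral_real_affine[where c=l and t=a]) auto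
  also have "\<dots> = (LINT v|lborel. LINT u|lborel. cis (2 * pi * a * x) * (of_real (bump u * bump v) *
      (cis (- 2 * pi * s * l * (u - v)) * M (a + l * (u - v))) * cis (2 * pi * (u + v) * (l * x))))"
    unfolding integral_scaleR_right[symmetric]
  proof (intro Bochner_Integration.integral_cong[OF refl])
    fix u v
    define m where "m = M (a + l * (u - v))"
    have "cis (- 2 * pi * s * (l * u)) * cis (2 * pi * s * (l * v)) * cis (2 * pi * (a + l * u + l * v) * x) =
      cis (2 * pi * a * x) * cis (- 2 * pi * s * l * (u - v)) * cis (2 * pi * (u + v) * (l * x))"
      by (simp add: cis_mult algebra_simps)
    then have "of_real (bump u * bump v) * M (a + l * (u - v)) * (cis (- 2 * pi * s * (l * u)) * cis (2 * pi * s * (l * v)) * cis (2 * pi * (a + l * u + l * v) * x)) =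
      of_real (bump u * bump v) * M (a + l * (u - v)) * (cis (2 * pi * a * x) * cis (- 2 * pi * s * l * (u - v)) * cis (2 * pi * (u + v) * (l * x)))"
      by simp
    moreover have "M (a + l * u - l * v) = m" by (simp add: m_def algebra_simps)
    ultimately show "l *\<^sub>R l *\<^sub>R ?B (a + l * u) (0 + l * v) = cis (2 * pi * a * x) * (of_real (bump u * bump v) *
      (cis (- 2 * pi * s * l * (u - v)) * M (a + l * (u - v))) * cis (2 * pi * (u + v) * (l * x)))"
      using assms by (simp add: wave_def scaleR_conv_of_real mult_ac flip: m_def)
  qed
  finally show ?thesis by (simp add: bump_form_def)
qed

lemma integrable_phi: "integrable lborel phi"
  by (rule integrable_ifourier[OF bump_test_fun])

lemma lp_norm_phi_finite:
  assumes "1 \<le> p"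
  shows "lp_norm p phi < \<infinity>"
  by (rule lp_norm_finite[OF integrable_phi norm_ifourier_le assms])

text \<open>The multiplier inequality is tested on two waves. The inputs contribute the exponents of
  \<open>1 / p1\<close> and \<open>1 / p2\<close>, undoing the dilation of the output that of
  \<open>1 / p3\<close>, and the constant depends on none of \<open>s\<close>, \<open>a\<close>,
  \<open>l\<close>.\<close>

lemma lp_norm_bump_form_le:
  assumes M: "M \<in> multiplier_class p1 p2 p3" "M \<in> borel_measurable borel"
    and p: "1 \<le> p1" "1 \<le> p2" "0 < p3"
  obtains K :: real where "0 \<le> K"
    "\<And>s a l. 0 < l \<Longrightarrow> lp_norm p3 (bump_form (\<lambda>t. cis (- 2 * pi * s * l * t) * M (a + l * t)))
      \<le> ennreal (K * l powr (real_of_ereal (1 / p3) - real_of_ereal (1 / p1) - real_of_ereal (1 / p2)))"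
proof -
  note [measurable] = M(2)
  have p': "0 < p1" "0 < p2" using p by (auto intro: less_le_trans[of _ 1])
  obtain C where C: "\<And>f g. f \<in> classP \<Longrightarrow> g \<in> classP \<Longrightarrow>
      lp_norm p3 (bilin_op M f g) \<le> ennreal C * lp_norm p1 f * lp_norm p2 g"
    using M(1) by (auto simp: multiplier_class_def)
  obtain A1 where A1: "lp_norm p1 phi = ennreal A1" "0 \<le> A1"
    using lp_norm_phi_finite[OF p(1)] by (cases "lp_norm p1 phi") auto
  obtain A2 where A2: "lp_norm p2 phi = ennreal A2" "0 \<le> A2"
    using lp_norm_phi_finite[OF p(2)] by (cases "lp_norm p2 phi") auto
  let ?r = "\<lambda>p. real_of_ereal (1 / p)"
  show thesis
  \<comment> \<open>\<open>C\<close> may be negative, in which case \<open>ennreal C\<close> is 0;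
    \<open>max C 0\<close> provides a nonnegative real constant.\<close>
  proof (rule that[of "max C 0 * A1 * A2"])
    show "0 \<le> max C 0 * A1 * A2" using A1 A2 by simp
    fix s a l :: real
    assume l: "0 < l"
    let ?F = "bump_form (\<lambda>t. cis (- 2 * pi * s * l * t) * M (a + l * t))"
    let ?f = "ifourier (wave s a l)" and ?g = "ifourier (wave (- s) 0 l)"
    have wave_le: "lp_norm p (ifourier (wave s a l)) \<le> ennreal (l powr - ?r p) * lp_norm p phi"
      if "0 < p" for p s a
    proof -
      have "lp_norm p (ifourier (wave s a l)) = lp_norm p (\<lambda>x. phi (- l * s + l * x))"
        by (rule lp_norm_cong) (rule norm_ifourier_wave[OF l])
      also have "\<dots> \<le> ennreal (l powr - ?r p) * lp_norm p phi"
        by (rule lp_norm_affine_le[OF ifourier_measurable[OF bump_test_fun] l that])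
      finally show ?thesis .
    qed
    have "lp_norm p3 ?F = lp_norm p3 (\<lambda>y. ?F (l * (0 + 1 / l * y)))"
      using l by simp
    also have "\<dots> \<le> ennreal ((1 / l) powr - ?r p3) * lp_norm p3 (\<lambda>x. ?F (l * x))"
      by (rule lp_norm_affine_le) (use l p in auto)
    also have "lp_norm p3 (\<lambda>x. ?F (l * x)) = lp_norm p3 (bilin_op M ?f ?g)"
      by (rule lp_norm_cong) (simp add: bilin_op_wave[OF l] norm_mult)
    also have "\<dots> \<le> ennreal C * lp_norm p1 ?f * lp_norm p2 ?g"
      by (intro C ifourier_in_classP wave_test_fun l)
    also have "\<dots> \<le> ennreal (max C 0) * (ennreal (l powr - ?r p1) * ennreal A1) * (ennreal (l powr - ?r p2) * ennreal A2)"
      using wave_le[OF p'(1)] wave_le[OF p'(2)] unfolding A1(1) A2(1)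
      by (intro mult_mono ennreal_leI) auto
    also have "ennreal ((1 / l) powr - ?r p3) * \<dots> =
        ennreal ((1 / l) powr - ?r p3 * (max C 0 * (l powr - ?r p1 * A1) * (l powr - ?r p2 * A2)))"
      using A1(2) A2(2) by (simp add: ennreal_mult)
    also have "(1 / l) powr - ?r p3 * (max C 0 * (l powr - ?r p1 * A1) * (l powr - ?r p2 * A2)) =
        max C 0 * A1 * A2 * l powr (?r p3 - ?r p1 - ?r p2)"
      using l by (simp add: powr_diff powr_add powr_minus powr_divide field_simps)
    finally show "lp_norm p3 ?F \<le> ennreal (max C 0 * A1 * A2 * l powr (?r p3 - ?r p1 - ?r p2))"
      by (simp add: mult_left_mono)
  qed
qed

section \<open>Limits for small and large dilations\<close>

lemma norm_LINT_le:
  fixes f :: "'a \<Rightarrow> complex"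
  assumes "integrable M w" "\<And>x. norm (f x) \<le> w x"
  shows "norm (LINT x|M. f x) \<le> (LINT x|M. w x)"
  by (rule order.trans[OF integral_norm_bound integral_mono'])
    (use assms order.trans[OF norm_ge_zero assms(2)] in auto)

lemma phi_0: "phi 0 = of_real (LINT u|lborel. bump u)"
  by (simp add: ifourier_def)

text \<open>Dominated convergence in the inner and then in the outer integral replaces the symbol by
  the constant \<open>M a\<close>; the exponential in \<open>u + v\<close> then splits, and each
  variable contributes one factor \<open>phi y\<close>.\<close>

lemma bump_form_tendsto_small:
  assumes M: "continuous_on UNIV M"
  shows "(\<lambda>n. bump_form (\<lambda>t. M (a + t / real (Suc n))) y) \<longlonglongrightarrow> M a * (phi y)\<^sup>2"
proof -
  have [measurable]: "M \<in> borel_measurable borel"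
    using M by (rule borel_measurable_continuous_onI)
  \<comment> \<open>Both bumps live in the unit interval around 0, so \<open>u - v\<close> stays
    within 2 and dividing by \<open>Suc n\<close> only shrinks it.\<close>
  have "bounded (M ` cball a 2)"
    by (intro compact_imp_bounded compact_continuous_image continuous_on_subset[OF M]) auto
  then obtain K where K: "0 < K" "\<And>t. t \<in> cball a 2 \<Longrightarrow> norm (M t) \<le> K"
    by (auto simp: bounded_pos)
  let ?B = "\<lambda>n v u. of_real (bump u * bump v) * M (a + (u - v) / real (Suc n)) * cis (2 * pi * (u + v) * y)"
  have bd: "norm (?B n v u) \<le> K * bump v * bump u" for n v u
  proof (cases "\<bar>u\<bar> < 1 \<and> \<bar>v\<bar> < 1")
    case True
    then have "\<bar>u - v\<bar> \<le> 2" by linarith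
    also have "2 \<le> 2 * real (Suc n)" by simp
    finally have "\<bar>(u - v) / real (Suc n)\<bar> \<le> 2" by (simp add: abs_divide divide_le_eq)
    then have "norm (M (a + (u - v) / real (Suc n))) \<le> K" by (intro K(2)) (simp add: dist_real_def)
    then have "norm (M (a + (u - v) / real (Suc n))) * (bump v * bump u) \<le> K * (bump v * bump u)"
      by (intro mult_right_mono mult_nonneg_nonneg bump_nonneg)
    then show ?thesis by (simp add: norm_mult bump_nonneg mult_ac)
  qed (auto simp: bump_eq_0 not_less)
  have lim: "(\<lambda>n. ?B n v u) \<longlonglongrightarrow> of_real (bump u * bump v) * M a * cis (2 * pi * (u + v) * y)" for u v
  proof (intro tendsto_intros)
    have "(\<lambda>n. a + (u - v) / real (Suc n)) \<longlonglongrightarrow> a + 0"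
      by (intro tendsto_intros LIMSEQ_Suc[OF lim_const_over_n[of "u - v"]])
    then show "(\<lambda>n. M (a + (u - v) / real (Suc n))) \<longlonglongrightarrow> M a"
      using continuous_on_tendsto_compose[OF M] by simp
  qed
  have inner: "(\<lambda>n. LINT u|lborel. ?B n v u) \<longlonglongrightarrow>
      (LINT u|lborel. of_real (bump u * bump v) * M a * cis (2 * pi * (u + v) * y))" for v
    by (rule integral_dominated_convergence[where w="\<lambda>u. K * bump v * bump u"])
      (use lim bd bump_integrable in auto)
  have "(\<lambda>n. LINT v|lborel. LINT u|lborel. ?B n v u) \<longlonglongrightarrow>
      (LINT v|lborel. LINT u|lborel. of_real (bump u * bump v) * M a * cis (2 * pi * (u + v) * y))"
  proof (rule integral_dominated_convergence[where w="\<lambda>v. K * (LINT u|lborel. bump u) * bump v"])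
    show "AE v in lborel. norm (LINT u|lborel. ?B n v u) \<le> K * (LINT u|lborel. bump u) * bump v" for n
    proof (intro AE_I2)
      fix v
      have "norm (LINT u|lborel. ?B n v u) \<le> (LINT u|lborel. K * bump v * bump u)"
        by (rule norm_LINT_le) (use bd bump_integrable in auto)
      then show "norm (LINT u|lborel. ?B n v u) \<le> K * (LINT u|lborel. bump u) * bump v"
        by (simp add: mult_ac)
    qed
  qed (use inner bump_integrable in auto)
  also have "(LINT v|lborel. LINT u|lborel. of_real (bump u * bump v) * M a * cis (2 * pi * (u + v) * y)) =
     (LINT v|lborel. LINT u|lborel. M a * (of_real (bump v) * cis (2 * pi * v * y)) * (of_real (bump u) * cis (2 * pi * u * y)))"
  proof (intro Bochner_Integration.integral_cong[OF refl])
    fix u v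
    have "cis (2 * pi * (u + v) * y) = cis (2 * pi * v * y) * cis (2 * pi * u * y)"
      by (simp add: cis_mult algebra_simps)
    then show "of_real (bump u * bump v) * M a * cis (2 * pi * (u + v) * y) =
      M a * (of_real (bump v) * cis (2 * pi * v * y)) * (of_real (bump u) * cis (2 * pi * u * y))"
      by (simp add: mult_ac)
  qed
  also have "\<dots> = M a * (phi y)\<^sup>2"
    by (simp add: ifourier_def power2_eq_square)
  finally show ?thesis by (simp add: bump_form_def)
qed

text \<open>Substituting \<open>u = v + t / l\<close> moves the dilation from \<open>M\<close> to a
  bump, at the cost of the Jacobian that the prefactor cancels. In the limit both bumps sit at
  \<open>v\<close>, hence the square and the argument \<open>2 * y\<close>, while the integral in
  \<open>t\<close> becomes \<open>fourier M s\<close>.\<close>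

lemma bump_form_tendsto_large:
  assumes M: "integrable lborel M" "continuous_on UNIV M"
  shows "(\<lambda>n. of_real (real (Suc n)) * bump_form (\<lambda>t. cis (- 2 * pi * s * real (Suc n) * t) * M (real (Suc n) * t)) y)
    \<longlonglongrightarrow> fourier M s * ifourier (\<lambda>u. of_real (bump u) * of_real (bump u)) (2 * y)"
proof -
  have [measurable]: "M \<in> borel_measurable borel"
    using M(2) by (rule borel_measurable_continuous_onI)
  define l where "l n = real (Suc n)" for n
  have l: "0 < l n" for n by (simp add: l_def)
  let ?N = "\<lambda>t. M t * cis (- 2 * pi * t * s)"
  let ?B = "\<lambda>n v t. of_real (bump (v + t / l n) * bump v) * ?N t * cis (2 * pi * (2 * v + t / l n) * y)"
  \<comment> \<open>Bounding the moving bump by 1 leaves a majorant integrable in \<open>t\<close>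
    and in \<open>v\<close>; the integrability of \<open>M\<close> enters here.\<close>
  have bd: "norm (?B n v t) \<le> bump v * norm (M t)" for n v t
    using mult_left_le_one_le[of "bump v * norm (M t)" "bump (v + t / l n)"]
    by (simp add: norm_mult bump_nonneg bump_le_1 mult_ac)
  have eq: "of_real (l n) * bump_form (\<lambda>t. cis (- 2 * pi * s * l n * t) * M (l n * t)) y =
      (LINT v|lborel. LINT t|lborel. ?B n v t)" for n
  proof -
    let ?A = "\<lambda>v u. of_real (bump u * bump v) * (cis (- 2 * pi * s * l n * (u - v)) * M (l n * (u - v))) * cis (2 * pi * (u + v) * y)"
    have "of_real (l n) * bump_form (\<lambda>t. cis (- 2 * pi * s * l n * t) * M (l n * t)) y =
        (LINT v|lborel. of_real (l n) * (LINT u|lborel. ?A v u))"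
      by (simp add: bump_form_def)
    also have "\<dots> = (LINT v|lborel. LINT t|lborel. ?A v (v + 1 / l n * t))"
    proof (rule Bochner_Integration.integral_cong[OF refl])
      fix v
      have "(LINT u|lborel. ?A v u) = (1 / l n) *\<^sub>R (LINT t|lborel. ?A v (v + 1 / l n * t))"
        using l[of n] by (subst lborel_integral_real_affine[where c="1 / l n" and t=v]) auto
      then show "of_real (l n) * (LINT u|lborel. ?A v u) = (LINT t|lborel. ?A v (v + 1 / l n * t))"
        using l[of n] by (simp add: scaleR_conv_of_real)
    qed
    also have "\<dots> = (LINT v|lborel. LINT t|lborel. ?B n v t)"
      using l[of n] by (intro Bochner_Integration.integral_cong refl) (simp add: mult_ac add_ac)
    finally show ?thesis .
  qed
  have lim: "(\<lambda>n. ?B n v t) \<longlonglongrightarrow> of_real (bump v * bump v) * ?N t * cis (2 * pi * (2 * v) * y)" for v t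
  proof -
    have t: "(\<lambda>n. t / l n) \<longlonglongrightarrow> 0"
      unfolding l_def using LIMSEQ_Suc[OF lim_const_over_n[of t]] by simp
    have "(\<lambda>n. v + t / l n) \<longlonglongrightarrow> v + 0" by (intro tendsto_intros t)
    then have 1: "(\<lambda>n. bump (v + t / l n)) \<longlonglongrightarrow> bump v"
      using continuous_on_tendsto_compose[OF bump_continuous[OF continuous_on_id, of UNIV]] by simp
    have "(\<lambda>n. 2 * pi * (2 * v + t / l n) * y) \<longlonglongrightarrow> 2 * pi * (2 * v + 0) * y"
      by (intro tendsto_intros t)
    then have 2: "(\<lambda>n. cis (2 * pi * (2 * v + t / l n) * y)) \<longlonglongrightarrow> cis (2 * pi * (2 * v) * y)"
      using continuous_on_tendsto_compose[OF continuous_on_cis[OF continuous_on_id, of UNIV]] by simp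
    show ?thesis by (intro tendsto_intros 1 2)
  qed
  have inner: "(\<lambda>n. LINT t|lborel. ?B n v t) \<longlonglongrightarrow>
      (LINT t|lborel. of_real (bump v * bump v) * ?N t * cis (2 * pi * (2 * v) * y))" for v
    by (rule integral_dominated_convergence[where w="\<lambda>t. bump v * norm (M t)"])
      (use lim bd M(1) in \<open>auto intro!: integrable_norm\<close>)
  have "(\<lambda>n. LINT v|lborel. LINT t|lborel. ?B n v t) \<longlonglongrightarrow>
      (LINT v|lborel. LINT t|lborel. of_real (bump v * bump v) * ?N t * cis (2 * pi * (2 * v) * y))"
  proof (rule integral_dominated_convergence[where w="\<lambda>v. bump v * (LINT t|lborel. norm (M t))"])
    show "AE v in lborel. norm (LINT t|lborel. ?B n v t) \<le> bump v * (LINT t|lborel. norm (M t))" for n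
    proof (intro AE_I2)
      fix v
      have "norm (LINT t|lborel. ?B n v t) \<le> (LINT t|lborel. bump v * norm (M t))"
        by (rule norm_LINT_le) (use bd M(1) in auto)
      then show "norm (LINT t|lborel. ?B n v t) \<le> bump v * (LINT t|lborel. norm (M t))"
        by simp
    qed
  qed (use inner bump_integrable in auto)
  also have "(LINT v|lborel. LINT t|lborel. of_real (bump v * bump v) * ?N t * cis (2 * pi * (2 * v) * y)) =
      (LINT v|lborel. LINT t|lborel. (of_real (bump v) * of_real (bump v) * cis (2 * pi * v * (2 * y))) * ?N t)"
    by (simp add: mult_ac)
  also have "\<dots> = fourier M s * ifourier (\<lambda>u. of_real (bump u) * of_real (bump u)) (2 * y)"
    unfolding fourier_def ifourier_def by (simp add: mult.commute)
  finally show ?thesis unfolding eq[symmetric] by (simp add: l_def)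
qed

text \<open>A bump supported where \<open>M\<close> is close to \<open>M t\<^sub>0\<close> is the Fourier transform of an integrable
  function, so by Fubini its integral against \<open>M\<close> only depends on \<open>fourier M\<close>.\<close>

lemma fourier_nonzero:
  assumes M: "integrable lborel M" "continuous_on UNIV M" and t0: "M t0 \<noteq> 0"
  shows "\<exists>s. fourier M s \<noteq> 0"
proof (rule ccontr)
  assume "\<nexists>s. fourier M s \<noteq> 0"
  then have M0: "fourier M s = 0" for s by blast
  have "isCont M t0" using M(2) by (simp add: continuous_on_eq_continuous_at)
  then obtain d where d: "0 < d" "\<And>t. dist t t0 < d \<Longrightarrow> dist (M t) (M t0) < norm (M t0) / 2"
    unfolding continuous_at_eps_delta using t0 by (metis half_gt_zero zero_less_norm_iff)
  define g where "g t = bump ((t - t0) / d)" for t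
  have "(\<lambda>t. complex_of_real (bump (1 / d * t + - t0 / d))) \<in> test_fun"
    using d(1) by (intro test_fun_affine[OF bump_test_fun]) auto
  then have a: "(\<lambda>t. complex_of_real (g t)) \<in> test_fun" (is "?a \<in> _")
    by (simp add: g_def[abs_def] diff_divide_distrib)
  have g_int: "integrable lborel g"
    using integrable_Re[OF test_fun_integrable[OF a]] by simp
  have "(LINT t|lborel. g t) = d * (LINT u|lborel. bump u)"
    using d(1) by (subst lborel_integral_real_affine[where c=d and t=t0]) (auto simp: g_def)
  then have g_pos: "0 < (LINT t|lborel. g t)"
    using bump_power_integral_pos(2)[of 0] d(1) by simp
  have Mg_int: "integrable lborel (\<lambda>t. M t * g t)"
    by (rule Bochner_Integration.integrable_bound[OF M(1)])
      (use borel_measurable_integrable[OF M(1)] borel_measurable_integrable[OF g_int] in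
        \<open>auto simp: norm_mult g_def bump_nonneg bump_le_1 intro!: mult_left_le\<close>)
  let ?F = "\<lambda>t x. M t * ifourier ?a x * cis (- 2 * pi * x * t)"
  have "(LINT t|lborel. M t * g t) = (LINT t|lborel. M t * fourier (ifourier ?a) t)"
    by (simp add: fourier_ifourier[OF a])
  also have "\<dots> = (LINT t|lborel. LINT x|lborel. ?F t x)"
    by (simp add: fourier_def mult.assoc)
  also have "\<dots> = (LINT x|lborel. LINT t|lborel. ?F t x)"
    using integrable_pair_cis[OF M(1) integrable_ifourier[OF a], of "\<lambda>(t, x). - 2 * pi * x * t"]
    by (intro lborel_pair.Fubini_integral[symmetric]) simp
  also have "\<dots> = (LINT x|lborel. ifourier ?a x * fourier M x)"
    unfolding fourier_def integral_mult_right_zero[symmetric] by (simp add: mult_ac)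
  finally have 0: "(LINT t|lborel. M t * g t) = 0" by (simp add: M0)
  \<comment> \<open>As the integral of \<open>M t * g t\<close> is 0, replacing \<open>M\<close> by
    \<open>M t0\<close> on the support of \<open>g\<close> would make a positive number at most half
    of itself.\<close>
  have "norm (M t0) * (LINT t|lborel. g t) = norm (LINT t|lborel. M t * g t - M t0 * g t)"
    using g_pos Mg_int test_fun_integrable[OF a] by (simp add: 0 norm_mult)
  also have "\<dots> \<le> (LINT t|lborel. norm (M t0) / 2 * g t)"
  proof (rule norm_LINT_le)
    show "integrable lborel (\<lambda>t. norm (M t0) / 2 * g t)" using g_int by simp
    fix t
    show "norm (M t * g t - M t0 * g t) \<le> norm (M t0) / 2 * g t"
    proof (cases "dist t t0 < d")
      case True
      then have "norm (M t - M t0) \<le> norm (M t0) / 2"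
        using d(2)[of t] by (simp add: dist_norm)
      then have "norm (M t - M t0) * g t \<le> norm (M t0) / 2 * g t"
        by (rule mult_right_mono) (simp add: g_def bump_nonneg)
      then show ?thesis
        by (simp add: g_def bump_nonneg norm_mult flip: left_diff_distrib)
    next
      case False
      then have "g t = 0"
        unfolding g_def using d(1) by (intro bump_eq_0) (simp add: dist_real_def abs_divide)
      then show ?thesis by simp
    qed
  qed
  also have "\<dots> = norm (M t0) / 2 * (LINT t|lborel. g t)" by simp
  finally show False using g_pos t0 by simp
qed

section \<open>Comparison of the powers of the dilation parameter\<close>

lemma one_divide_ereal: "0 < p \<Longrightarrow> 1 / p = ereal (real_of_ereal (1 / p))"
  by (cases p) (auto simp: one_ereal_def)

text \<open>A negative power of \<open>Suc n\<close> tends to 0, so it cannot stay above a positive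
  constant.\<close>

lemma powr_bounded_below_imp_nonneg:
  assumes "0 < c" "eventually (\<lambda>n. c \<le> K * real (Suc n) powr e) sequentially"
  shows "0 \<le> e"
proof (rule ccontr)
  assume "\<not> 0 \<le> e"
  then have "(\<lambda>n. K * real (Suc n) powr e) \<longlonglongrightarrow> K * 0"
    by (intro tendsto_intros tendsto_neg_powr filterlim_compose[OF filterlim_real_sequentially filterlim_Suc]) auto
  then have "c \<le> K * 0"
    using assms(2) by (rule tendsto_lowerbound) simp
  then show False using assms(1) by simp
qed

theorem mainTheorem12:
  fixes p1 p2 p3 :: ereal and M :: "real \<Rightarrow> complex"
  assumes "1 \<le> p1" and "1 \<le> p2" and "0 < p3"
    and "continuous_on UNIV M" and "integrable lborel M" and "M \<noteq> (\<lambda>_. 0)"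
    and "M \<in> multiplier_class p1 p2 p3"
  shows "1 / p3 \<le> 1 / p1 + 1 / p2 \<and> 1 / p1 + 1 / p2 \<le> 1 / p3 + 1"
proof -
  let ?r = "\<lambda>p. real_of_ereal (1 / p)"
  define e where "e = ?r p3 - ?r p1 - ?r p2"
  have [measurable]: "M \<in> borel_measurable borel"
    using assms(4) by (rule borel_measurable_continuous_onI)
  obtain K where K: "0 \<le> K" "\<And>s a l. 0 < l \<Longrightarrow>
      lp_norm p3 (bump_form (\<lambda>t. cis (- 2 * pi * s * l * t) * M (a + l * t))) \<le> ennreal (K * l powr e)"
    unfolding e_def using lp_norm_bump_form_le[OF assms(7) _ assms(1-3)] by auto
  obtain t0 where t0: "M t0 \<noteq> 0" using assms(6) by (auto simp: fun_eq_iff)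
  obtain s where s: "fourier M s \<noteq> 0" using fourier_nonzero[OF assms(5,4) t0] by blast
  \<comment> \<open>The first inequality: dilation \<open>1 / real (Suc n)\<close>, no modulation,
    and the symbol centred at \<open>t0\<close>, so that the limit at \<open>y = 0\<close> is
    nonzero.\<close>
  have "0 \<le> - e"
  proof -
    obtain c where c: "0 < c"
      "eventually (\<lambda>n. ennreal c \<le> lp_norm p3 (bump_form (\<lambda>t. M (t0 + t / real (Suc n))))) sequentially"
    proof (rule lp_norm_eventually_bounded_below[OF _ bump_form_tendsto_small[OF assms(4), of t0]])
      show "continuous_on UNIV (\<lambda>y. M t0 * (phi y)\<^sup>2)"
        by (intro continuous_intros ifourier_continuous bump_test_fun)
      show "M t0 * (phi 0)\<^sup>2 \<noteq> 0"
        using t0 bump_power_integral_pos(2)[of 0] by (simp add: phi_0)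
    qed (use assms(3) in \<open>auto intro!: bump_form_measurable\<close>)
    have "eventually (\<lambda>n. c \<le> K * real (Suc n) powr - e) sequentially"
      using c(2)
    proof eventually_elim
      case (elim n)
      also have "lp_norm p3 (bump_form (\<lambda>t. M (t0 + t / real (Suc n)))) \<le> ennreal (K * (1 / real (Suc n)) powr e)"
        using K(2)[of "1 / real (Suc n)" 0 t0] by simp
      finally show ?case
        using K(1) by (simp add: ennreal_le_iff powr_divide powr_minus_divide)
    qed
    with c(1) show ?thesis by (rule powr_bounded_below_imp_nonneg)
  qed
  \<comment> \<open>The second inequality: dilation \<open>real (Suc n)\<close>, modulation
    \<open>s\<close>, centre 0. The factor that normalises the limit raises the exponent by one,
    which is the 1 in the conclusion.\<close>
  moreover have "0 \<le> e + 1"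
  proof -
    let ?F = "\<lambda>n. bump_form (\<lambda>t. cis (- 2 * pi * s * real (Suc n) * t) * M (real (Suc n) * t))"
    let ?a = "\<lambda>u. complex_of_real (bump u) * of_real (bump u)"
    have a: "?a \<in> test_fun"
      by (rule test_fun_mult[OF bump_test_fun]) (use bump_test_fun in \<open>simp add: test_fun_def\<close>)
    obtain c where c: "0 < c"
      "eventually (\<lambda>n. ennreal c \<le> lp_norm p3 (\<lambda>y. of_real (real (Suc n)) * ?F n y)) sequentially"
    proof (rule lp_norm_eventually_bounded_below[OF _ bump_form_tendsto_large[OF assms(5,4), of s]])
      show "continuous_on UNIV (\<lambda>y. fourier M s * ifourier ?a (2 * y))"
        by (intro continuous_intros continuous_on_compose2[OF ifourier_continuous[OF a, of UNIV]]) auto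
      have "ifourier ?a (2 * 0) = of_real (LINT u|lborel. bump u ^ Suc 1)"
        unfolding ifourier_def integral_complex_of_real[symmetric] by simp
      then show "fourier M s * ifourier ?a (2 * 0) \<noteq> 0"
        using s bump_power_integral_pos(2)[of 1] by simp
    qed (use assms(3) in \<open>auto intro!: borel_measurable_times bump_form_measurable\<close>)
    have "eventually (\<lambda>n. c \<le> K * real (Suc n) powr (e + 1)) sequentially"
      using c(2)
    proof eventually_elim
      case (elim n)
      also have "lp_norm p3 (\<lambda>y. of_real (real (Suc n)) * ?F n y) \<le> ennreal (real (Suc n)) * lp_norm p3 (?F n)"
        by (rule lp_norm_cmult_le) (use assms(3) in auto)
      also have "\<dots> \<le> ennreal (real (Suc n)) * ennreal (K * real (Suc n) powr e)"
        using K(2)[of "real (Suc n)" s 0] by (intro mult_left_mono) auto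
      also have "\<dots> = ennreal (real (Suc n) * (K * real (Suc n) powr e))"
        by (rule ennreal_mult[symmetric]) (use K(1) in simp_all)
      also have "real (Suc n) * (K * real (Suc n) powr e) = K * real (Suc n) powr (e + 1)"
        by (simp only: powr_add powr_one of_nat_0_le_iff mult_ac)
      finally show ?case using K(1) by (simp add: ennreal_le_iff)
    qed
    with c(1) show ?thesis by (rule powr_bounded_below_imp_nonneg)
  qed
  ultimately have "?r p3 \<le> ?r p1 + ?r p2" "?r p1 + ?r p2 \<le> ?r p3 + 1"
    by (simp_all add: e_def)
  then have "ereal (?r p3) \<le> ereal (?r p1) + ereal (?r p2)" "ereal (?r p1) + ereal (?r p2) \<le> ereal (?r p3) + 1"
    by (simp_all add: one_ereal_def)
  moreover have "0 < p1" "0 < p2"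
    using assms(1,2) by (auto intro: less_le_trans[of _ 1])
  ultimately show ?thesis
    using assms(3) by (simp only: one_divide_ereal[symmetric])
qed

end
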